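(* Let $p$ be an odd prime, write $\frac{p+1}{8}=\frac{m}{n}$ in lowest terms, and let $A_p=(a_{i,h})_{0\le i,h\le m}$ be the integer matrix with $a_{0,0}=1$, $a_{i,h}=0$ for $i+h>m$, and $\sum_{i,h=0}^m a_{i,h}X^iY^h=0$ identically on the upper half plane. Then $$\sum_{h=0}^{m}a_{1,h}=-n^m2^{m-n},$$ $$\sum_{h=0}^{m}(1+2h)\,a_{1,h}=-n^m2^{m+1-n}P_1(m),$$ $$\sum_{h=0}^{m}(1+2h)^2a_{1,h}=-n^m2^{m+3-n}P_2(m)-n^{m-1}2^{m+1-n}\alpha_p(2)-n^{m-2}2^{m+1-n}\,m\,\alpha_p(3).$$
   Context: For an odd prime $p$, $m,n$ are the coprime positive integers with $\frac{p+1}{8}=\frac mn$ (so $n\in\{1,2,4\}$). For $\tau$ in the upper half plane put $q=e^{i\pi\tau}$ and $Q(\tau)=\prod_{k\ge1}(1-q^k)$. The modular lambda function is $\lambda(\tau)=\theta_2^4(\tau)/\theta_3^4(\tau)$; one has $\lambda(\tau)=16q\,\frac{Q^8(\tau)Q^{16}(4\tau)}{Q^{24}(2\tau)}$ and $1-\lambda(\tau)=\frac{Q^{16}(\tau)Q^{8}(4\tau)}{Q^{24}(2\tau)}$. Put $$X=(\lambda(\tau)\lambda(p\tau))^{n/8},\qquad Y=((1-\lambda(\tau))(1-\lambda(p\tau)))^{n/8},$$ with roots taken through the product formulas, i.e. $$X=2^nq^m\frac{Q^n(\tau)Q^{2n}(4\tau)}{Q^{3n}(2\tau)}\cdot\frac{Q^n(p\tau)Q^{2n}(4p\tau)}{Q^{3n}(2p\tau)},\qquad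 Y=\frac{Q^{2n}(\tau)Q^{n}(4\tau)}{Q^{3n}(2\tau)}\cdot\frac{Q^{2n}(p\tau)Q^{n}(4p\tau)}{Q^{3n}(2p\tau)}.$$ It is a known theorem (Russell), taken as given, that an integer matrix $A_p$ with the stated properties exists. With the convention that $\sigma_1(x)/x$ is replaced by $0$ when $x$ is not a positive integer ($\sigma_1$ is the sum-of-divisors function), $$\alpha_p(k)=\frac{\sigma_1(k)}{k}-3\frac{\sigma_1(k/2)}{k/2}+2\frac{\sigma_1(k/4)}{k/4}+\frac{\sigma_1(k/p)}{k/p}-3\frac{\sigma_1(k/2p)}{k/2p}+2\frac{\sigma_1(k/4p)}{k/4p}.$$ The polynomials $P_k$ are defined by $\sum_{h=0}^m h^N(-1)^{h-1}\binom mh=(-1)^{m-1}P_{N-m}(m)\,N!$ for $N\ge m$; in particular $P_1(m)=\frac m2$ and $P_2(m)=\frac{m(3m+1)}{24}$. *)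

theory Defs
  imports "HOL-Analysis.Analysis"
begin

definition nome :: "complex \<Rightarrow> complex" where
  "nome \<tau> = exp (\<i> * of_real pi * \<tau>)"

definition Qprod :: "complex \<Rightarrow> complex" where
  "Qprod \<tau> = (\<Prod>k. 1 - nome \<tau> ^ Suc k)"

text \<open>
  Informally, \<open>X = (\<lambda>(\<tau>) \<lambda>(p \<tau>))\<close> to the power \<open>n / 8\<close> and
  \<open>Y = ((1 - \<lambda>(\<tau>)) (1 - \<lambda>(p \<tau>)))\<close> to the power \<open>n / 8\<close>, where \<open>\<lambda>\<close> is the
  modular lambda function. The branch of the root is the one given by the product formulas
  for \<open>\<lambda>\<close> and \<open>1 - \<lambda>\<close>, and these products serve as the definition;
  \<open>m\<close> is meant to satisfy \<open>8 m = n (p + 1)\<close>.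
\<close>

definition modX :: "nat \<Rightarrow> nat \<Rightarrow> nat \<Rightarrow> complex \<Rightarrow> complex" where
  "modX p m n \<tau> =
     2 ^ n * nome \<tau> ^ m
     * (Qprod \<tau> ^ n * Qprod (4 * \<tau>) ^ (2 * n) / Qprod (2 * \<tau>) ^ (3 * n))
     * (Qprod (of_nat p * \<tau>) ^ n * Qprod (4 * of_nat p * \<tau>) ^ (2 * n)
        / Qprod (2 * of_nat p * \<tau>) ^ (3 * n))"

definition modY :: "nat \<Rightarrow> nat \<Rightarrow> complex \<Rightarrow> complex" where
  "modY p n \<tau> =
     (Qprod \<tau> ^ (2 * n) * Qprod (4 * \<tau>) ^ n / Qprod (2 * \<tau>) ^ (3 * n))
     * (Qprod (of_nat p * \<tau>) ^ (2 * n) * Qprod (4 * of_nat p * \<tau>) ^ n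
        / Qprod (2 * of_nat p * \<tau>) ^ (3 * n))"

text \<open>Only the entries \<open>a i h\<close> with \<open>i, h \<le> m\<close> are constrained: \<open>a\<close> encodes an
  \<open>(m + 1) \<times> (m + 1)\<close> matrix with indices starting at 0.\<close>

definition is_modular_matrix :: "nat \<Rightarrow> nat \<Rightarrow> nat \<Rightarrow> (nat \<Rightarrow> nat \<Rightarrow> int) \<Rightarrow> bool" where
  "is_modular_matrix p m n a \<longleftrightarrow>
     a 0 0 = 1 \<and>
     (\<forall>i\<le>m. \<forall>h\<le>m. i + h > m \<longrightarrow> a i h = 0) \<and>
     (\<forall>\<tau>. Im \<tau> > 0 \<longrightarrow>
        (\<Sum>i=0..m. \<Sum>h=0..m. of_int (a i h) * modX p m n \<tau> ^ i * modY p n \<tau> ^ h) = 0)"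

definition sigma1 :: "nat \<Rightarrow> nat" where
  "sigma1 k = \<Sum>{d. d dvd k}"

text \<open>\<open>\<sigma>\<^sub>1(x) / x\<close>, read as 0 unless \<open>x\<close> is a positive integer.\<close>

definition sigma1_ratio :: "real \<Rightarrow> real" where
  "sigma1_ratio x = (if x \<in> \<int> \<and> x > 0 then real (sigma1 (nat \<lfloor>x\<rfloor>)) / x else 0)"

definition alpha :: "nat \<Rightarrow> nat \<Rightarrow> real" where
  "alpha p k =
     sigma1_ratio (real k) - 3 * sigma1_ratio (real k / 2) + 2 * sigma1_ratio (real k / 4)
     + sigma1_ratio (real k / real p) - 3 * sigma1_ratio (real k / (2 * real p))
     + 2 * sigma1_ratio (real k / (4 * real p))"

text \<open>The defining identity of the polynomial \<open>P\<^sub>k\<close>, with \<open>N = m + k\<close>. The exponent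
  \<open>h - 1\<close> is an integer, as \<open>h = 0\<close> occurs in the sum.\<close>

definition is_P :: "nat \<Rightarrow> real poly \<Rightarrow> bool" where
  "is_P k P \<longleftrightarrow>
     (\<forall>m::nat. (\<Sum>h=0..m. real h ^ (m + k) * (- 1) powi (int h - 1) * real (m choose h))
        = (- 1) powi (int m - 1) * poly P (real m) * fact (m + k))"

lemma is_P_unique:
  assumes "is_P k P" "is_P k R"
  shows "P = R"
proof -
  have eq: "poly (P - R) (real m) = 0" for m :: nat
  proof -
    have "(- 1 :: real) powi (int m - 1) * poly P (real m) * fact (m + k)
        = (- 1) powi (int m - 1) * poly R (real m) * fact (m + k)"
      using assms unfolding is_P_def by metis
    then show ?thesis by (simp add: power_int_eq_0_iff)
  qed
  have "infinite (range real)"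
    by (simp add: finite_image_iff)
  moreover have "range real \<subseteq> {x. poly (P - R) x = 0}"
    using eq by auto
  ultimately have "infinite {x. poly (P - R) x = 0}"
    using finite_subset by blast
  then have "P - R = 0"
    using poly_roots_finite by blast
  then show ?thesis by simp
qed

lemma is_P_exists: "\<exists>P. is_P k P"
proof -
  define F :: "real fps" where "F = Abs_fps (\<lambda>n. 1 / fact (Suc n))"
  define G where "G = F - 1"
  have XF: "fps_X * F = fps_exp 1 - 1"
  proof (rule fps_ext)
    fix n show "fps_nth (fps_X * F) n = fps_nth (fps_exp 1 - 1) n"
      by (cases n) (simp_all add: F_def fps_X_mult_nth field_simps)
  qed
  define P :: "real poly" where
    "P = (\<Sum>j\<le>k. smult (fps_nth (G ^ j) k / fact j) (\<Prod>i<j. [:- real i, 1:]))"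
  have G0: "fps_nth G 0 = 0" by (simp add: G_def F_def)
  have PP: "poly P (real m) = fps_nth (F ^ m) k" for m
  proof -
    have *: "fps_nth (G ^ j) k = 0" if "j > k" for j
      using G0 that startsby_zero_power_prefix[of G j] by blast
    have "F ^ m = (G + 1) ^ m" by (simp add: G_def)
    also have "\<dots> = (\<Sum>j\<le>m. of_nat (m choose j) * G ^ j)"
      by (simp add: binomial_ring)
    finally have "fps_nth (F ^ m) k = (\<Sum>j\<le>m. real (m choose j) * fps_nth (G ^ j) k)"
      by (simp add: fps_sum_nth fps_of_nat [symmetric])
    also have "\<dots> = (\<Sum>j\<le>m + k. real (m choose j) * fps_nth (G ^ j) k)"
      by (rule sum.mono_neutral_left) auto
    also have "\<dots> = (\<Sum>j\<le>k. real (m choose j) * fps_nth (G ^ j) k)"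
      by (rule sum.mono_neutral_right) (auto simp: *)
    also have "\<dots> = poly P (real m)"
      by (simp add: P_def poly_sum poly_prod binomial_gbinomial gbinomial_prod_rev
          atLeast0LessThan field_simps)
    finally show ?thesis by simp
  qed
  have "(\<Sum>h=0..m. real h ^ (m + k) * (- 1) powi (int h - 1) * real (m choose h))
        = (- 1) powi (int m - 1) * poly P (real m) * fact (m + k)" for m
  proof -
    have "(fps_exp 1 - 1 :: real fps) ^ m = (fps_exp 1 + (- 1)) ^ m" by simp
    also have "\<dots> = (\<Sum>h\<le>m. of_nat (m choose h) * fps_exp 1 ^ h * (- 1) ^ (m - h))"
      by (rule binomial_ring)
    also have "\<dots> = (\<Sum>h\<le>m. fps_const (real (m choose h) * (- 1) ^ (m - h)) * fps_exp (real h))"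
    proof (intro sum.cong refl)
      fix h
      have "(- 1 :: real fps) ^ (m - h) = fps_const ((- 1) ^ (m - h))"
        by (metis fps_const_1_eq_1 fps_const_neg fps_const_power)
      then show "of_nat (m choose h) * fps_exp 1 ^ h * (- 1) ^ (m - h)
          = fps_const (real (m choose h) * (- 1) ^ (m - h)) * fps_exp (real h)"
        by (simp only: fps_of_nat [symmetric] fps_exp_power_mult fps_const_mult [symmetric]
            mult_1_left mult_1_right mult_ac)
    qed
    finally have "fps_nth ((fps_exp 1 - 1 :: real fps) ^ m) (m + k)
        = (\<Sum>h\<le>m. real (m choose h) * (- 1) ^ (m - h) * real h ^ (m + k) / fact (m + k))"
      by (simp add: fps_sum_nth)
    moreover have "fps_nth ((fps_exp 1 - 1 :: real fps) ^ m) (m + k) = poly P (real m)"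
      by (simp add: XF [symmetric] power_mult_distrib fps_X_power_mult_nth PP)
    ultimately have "poly P (real m) * fact (m + k)
        = (\<Sum>h\<le>m. real (m choose h) * (- 1) ^ (m - h) * real h ^ (m + k))"
      by (simp add: sum_divide_distrib [symmetric])
    then have "(- 1) powi (int m - 1) * poly P (real m) * fact (m + k)
        = (\<Sum>h\<le>m. (- 1) powi (int m - 1) * (real (m choose h) * (- 1) ^ (m - h) * real h ^ (m + k)))"
      by (simp add: mult.assoc sum_distrib_left)
    also have "\<dots> = (\<Sum>h\<le>m. real h ^ (m + k) * (- 1) powi (int h - 1) * real (m choose h))"
    proof (rule sum.cong)
      fix h assume "h \<in> {..m}"
      then obtain d where d: "m = h + d" using le_Suc_ex by auto
      have "(- 1 :: real) powi (int m - 1) = (- 1) powi (int h - 1) * (- 1) ^ d"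
        by (simp add: d power_int_diff power_int_add power_int_minus power_add)
      moreover have "(- 1 :: real) ^ d * (- 1) ^ d = 1"
        by (simp flip: power_mult_distrib)
      ultimately have sgn: "(- 1 :: real) powi (int m - 1) * (- 1) ^ (m - h) = (- 1) powi (int h - 1)"
        by (simp add: d)
      have "(- 1) powi (int m - 1) * (real (m choose h) * (- 1) ^ (m - h) * real h ^ (m + k))
        = ((- 1) powi (int m - 1) * (- 1) ^ (m - h)) * (real (m choose h) * real h ^ (m + k))"
        by (simp only: mult_ac)
      also have "\<dots> = real h ^ (m + k) * (- 1) powi (int h - 1) * real (m choose h)"
        unfolding sgn by (simp only: mult_ac)
      finally show "(- 1) powi (int m - 1) * (real (m choose h) * (- 1) ^ (m - h) * real h ^ (m + k))
        = real h ^ (m + k) * (- 1) powi (int h - 1) * real (m choose h)" .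
    qed simp
    finally show ?thesis by (simp add: atMost_atLeast0)
  qed
  then show ?thesis unfolding is_P_def by blast
qed

definition Ppoly :: "nat \<Rightarrow> real poly" where
  "Ppoly k = (THE P. is_P k P)"

lemma is_P_Ppoly: "is_P k (Ppoly k)"
  unfolding Ppoly_def by (rule theI') (use is_P_exists is_P_unique in blast)

end

theory Submission
  imports Defs "HOL-Complex_Analysis.Complex_Analysis"
begin

text \<open>
  Put \<open>q = nome \<tau>\<close>. Then \<open>X = 2\<^sup>n q\<^sup>m x(q)\<close> and \<open>Y = y(q)\<close> for power series \<open>x, y\<close> with constant
  term 1, and the relation between \<open>X\<close> and \<open>Y\<close> becomes an identity of formal power series
  in \<open>q\<close> (\<open>modular_relation_fps\<close>). With \<open>R\<^sub>i = \<Sum>\<^sub>h a\<^sub>i\<^sub>h y\<^sup>h\<close> it reads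
  \<open>R\<^sub>0 + 2\<^sup>n q\<^sup>m x R\<^sub>1 + O(q\<^sup>2\<^sup>m) = 0\<close>.

  Hence \<open>R\<^sub>0 = O(q\<^sup>m)\<close>. As \<open>y - 1\<close> has a simple zero at \<open>q = 0\<close>, this says that the
  polynomial \<open>\<Sum>\<^sub>h a\<^sub>0\<^sub>h T\<^sup>h\<close>, whose degree is at most \<open>m\<close>, vanishes to order \<open>m\<close> at \<open>T = 1\<close>;
  since its value at \<open>0\<close> is \<open>a\<^sub>0\<^sub>0 = 1\<close>, it is \<open>(1 - T)\<^sup>m\<close>. Dividing by \<open>q\<^sup>m\<close> leaves
  \<open>2\<^sup>n x R\<^sub>1 = - ((1 - y) / q)\<^sup>m + O(q\<^sup>m)\<close> (\<open>second_row_from_relation\<close>), and the three claims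
  are its coefficients of \<open>q\<^sup>0, q\<^sup>1, q\<^sup>2\<close>.

  To read these off one takes logarithms of the products: \<open>log x = - n (q + \<alpha>(2) q\<^sup>2 + \<dots>)\<close> and
  \<open>log y = - 2 n (q + \<alpha>(3) q\<^sup>3 + \<dots>)\<close>, the latter without a \<open>q\<^sup>2\<close> term. So, up to higher order,
  \<open>x\<close> equals \<open>y\<^sup>1\<^sup>/\<^sup>2 exp (- n \<alpha>(2) q\<^sup>2)\<close>, which is why the moments of \<open>a\<^sub>1\<^sub>h\<close> with respect
  to \<open>1 + 2h\<close> appear in \<open>x R\<^sub>1\<close> (\<open>low_order_moments\<close>). On the other side, with \<open>u = log y\<close>,
  \<open>((1 - y) / q)\<^sup>m\<close> is \<open>(- u / q)\<^sup>m ((e\<^sup>u - 1) / u)\<^sup>m\<close>, and the numbers \<open>P\<^sub>k(m)\<close> are the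
  coefficients of \<open>((e\<^sup>u - 1) / u)\<^sup>m\<close> (\<open>poly_Ppoly_eq_fps_nth\<close>).

  The comparison of all three coefficients needs \<open>m \<ge> 3\<close>. The value \<open>m = 2\<close> would force \<open>p = 15\<close>.
  For \<open>m = 1\<close>, where \<open>p\<close> is 3 or 7, only the coefficient of \<open>q\<^sup>0\<close> is available; but then
  \<open>a\<^sub>1\<^sub>1 = 0\<close>, so the three sums all equal \<open>a\<^sub>1\<^sub>0\<close>, and the claims are numerical identities.
\<close>

section \<open>Logarithms and low-order coefficients of formal power series\<close>

text \<open>The logarithm of \<open>F / F(0)\<close>, by integrating the logarithmic derivative of \<open>F\<close>.\<close>
definition fps_log :: "'a::field_char_0 fps \<Rightarrow> 'a fps" where
  "fps_log F = fps_integral0 (fps_deriv F * inverse F)"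

text \<open>Both sides vanish at 0 and have the same derivative.\<close>
lemma fps_log_eqI:
  assumes "fps_nth F 0 \<noteq> 0" "fps_nth L 0 = 0" "fps_deriv F = fps_deriv L * F"
  shows "fps_log F = L"
proof -
  have "fps_deriv F * inverse F = fps_deriv L * (inverse F * F)"
    using assms(3) by (simp add: mult_ac)
  then show ?thesis
    using assms(1,2) by (simp add: inverse_mult_eq_1 fps_log_def fps_integral0_deriv)
qed

lemma fps_log_nth_0 [simp]: "fps_nth (fps_log F) 0 = 0"
  by (simp add: fps_log_def)

lemma fps_deriv_eq_log:
  assumes "fps_nth F 0 \<noteq> 0"
  shows "fps_deriv F = fps_deriv (fps_log F) * F"
proof -
  have "fps_deriv (fps_log F) * F = fps_deriv F * (inverse F * F)"
    by (simp add: fps_log_def fps_deriv_fps_integral mult_ac)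
  then show ?thesis using assms by (simp add: inverse_mult_eq_1)
qed

lemma fps_log_1 [simp]: "fps_log 1 = 0"
  by (rule fps_log_eqI) auto

lemma fps_log_mult:
  assumes "fps_nth F 0 \<noteq> 0" "fps_nth G 0 \<noteq> 0"
  shows "fps_log (F * G) = fps_log F + fps_log G"
  using fps_deriv_eq_log[OF assms(1)] fps_deriv_eq_log[OF assms(2)] assms
  by (intro fps_log_eqI) (simp_all add: algebra_simps)

lemma fps_log_inverse:
  assumes "fps_nth F 0 \<noteq> 0"
  shows "fps_log (inverse F) = - fps_log F"
  using fps_log_mult[of F "inverse F"] assms
  by (simp add: inverse_mult_eq_1' eq_neg_iff_add_eq_0 add.commute)

lemma fps_log_power:
  assumes "fps_nth F 0 \<noteq> 0"
  shows "fps_log (F ^ n) = of_nat n * fps_log F"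
  by (induction n) (use assms in \<open>simp_all add: fps_log_mult fps_power_zeroth algebra_simps\<close>)

lemma fps_log_prod:
  assumes "\<And>i. i \<in> A \<Longrightarrow> fps_nth (F i) 0 \<noteq> 0"
  shows "fps_log (\<Prod>i\<in>A. F i) = (\<Sum>i\<in>A. fps_log (F i))"
proof -
  have nz: "fps_nth (\<Prod>i\<in>B. F i) 0 \<noteq> 0" if "\<And>i. i \<in> B \<Longrightarrow> fps_nth (F i) 0 \<noteq> 0" for B
    using that by (induction B rule: infinite_finite_induct) auto
  from assms show ?thesis
    by (induction A rule: infinite_finite_induct) (auto simp: nz fps_log_mult)
qed

lemma fps_log_compose:
  assumes "fps_nth F 0 \<noteq> 0" "fps_nth G 0 = 0"
  shows "fps_log (F oo G) = fps_log F oo G"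
proof (rule fps_log_eqI)
  show "fps_deriv (F oo G) = fps_deriv (fps_log F oo G) * (F oo G)"
    using fps_deriv_eq_log[OF assms(1)] assms
    by (simp add: fps_compose_deriv fps_compose_mult_distrib algebra_simps)
qed (use assms in auto)

lemma fps_nth_compose_X_power:
  assumes "r > 0"
  shows "fps_nth (F oo (fps_X :: 'a::comm_ring_1 fps) ^ r) k = (if r dvd k then fps_nth F (k div r) else 0)"
proof -
  have "fps_nth (F oo fps_X ^ r) k = (\<Sum>i\<in>{0..k}. if k = r * i then fps_nth F i else 0)"
    unfolding fps_compose_nth by (intro sum.cong refl) (simp flip: power_mult)
  also have "\<dots> = (if r dvd k then fps_nth F (k div r) else 0)"
  proof (cases "r dvd k")
    case True
    then obtain j where j: "k = r * j" by auto
    have "(\<Sum>i\<in>{0..k}. if k = r * i then fps_nth F i else 0)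
        = (\<Sum>i\<in>{0..k}. if i = j then fps_nth F i else 0)"
      using assms by (intro sum.cong) (auto simp: j)
    then show ?thesis using assms by (auto simp: j)
  qed (auto intro!: sum.neutral)
  finally show ?thesis .
qed

lemma fps_log_one_minus_X_nth:
  "fps_nth (fps_log (1 - fps_X :: 'a::field_char_0 fps)) k = (if k = 0 then 0 else - 1 / of_nat k)"
proof -
  define L :: "'a fps" where "L = Abs_fps (\<lambda>k. if k = 0 then 0 else - 1 / of_nat k)"
  have "fps_deriv L = - Abs_fps (\<lambda>_. 1)"
    by (rule fps_ext) (simp add: L_def del: of_nat_Suc)
  moreover have "Abs_fps (\<lambda>_. 1 :: 'a) * (1 - fps_X) = 1"
    unfolding fps_inverse_gp' [symmetric] by (simp add: inverse_mult_eq_1')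
  ultimately have "fps_log (1 - fps_X) = L"
    by (intro fps_log_eqI) (simp_all add: L_def)
  then show ?thesis by (simp add: L_def)
qed

text \<open>The first terms of \<open>exp L\<close>, from the recursion \<open>F' = L' F\<close>.\<close>
lemma fps_nth_from_log:
  assumes "fps_nth F 0 = 1"
  defines "L \<equiv> fps_nth (fps_log F)"
  shows "fps_nth F 1 = L 1"
    and "fps_nth F 2 = L 2 + L 1 ^ 2 / 2"
    and "fps_nth F 3 = L 3 + L 1 * L 2 + L 1 ^ 3 / 6"
proof -
  have rec: "fps_deriv F = fps_deriv (fps_log F) * F"
    using assms by (intro fps_deriv_eq_log) simp
  have coeff: "fps_nth (fps_deriv F) j = fps_nth (fps_deriv (fps_log F) * F) j" for j
    by (rule arg_cong[OF rec])
  have e: "fps_nth F 1 = L 1" "2 * fps_nth F 2 = 2 * L 2 + L 1 * fps_nth F 1"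
    "3 * fps_nth F 3 = 3 * L 3 + 2 * L 2 * fps_nth F 1 + L 1 * fps_nth F 2"
    using assms(1) coeff[of 0] coeff[of 1] coeff[of 2]
    by (simp_all add: fps_mult_nth L_def eval_nat_numeral mult_ac)
  show e1: "fps_nth F 1 = L 1" by fact
  show e2: "fps_nth F 2 = L 2 + L 1 ^ 2 / 2"
    using e(2) e1 by (simp add: field_simps power2_eq_square)
  have "3 * fps_nth F 3 / 3 = (3 * L 3 + 2 * L 2 * fps_nth F 1 + L 1 * fps_nth F 2) / 3"
    by (simp only: e(3))
  then have "fps_nth F 3 = (3 * L 3 + 2 * L 2 * fps_nth F 1 + L 1 * fps_nth F 2) / 3"
    by simp
  then show "fps_nth F 3 = L 3 + L 1 * L 2 + L 1 ^ 3 / 6"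
    unfolding e1 e2 by (simp add: field_simps eval_nat_numeral)
qed

lemma fps_power_nth_low:
  fixes F :: "'a::field_char_0 fps"
  assumes "fps_nth F 0 = 1"
  shows "fps_nth (F ^ k) 1 = of_nat k * fps_nth F 1"
    and "fps_nth (F ^ k) 2 = of_nat k * fps_nth F 2 + of_nat k * (of_nat k - 1) / 2 * fps_nth F 1 ^ 2"
proof -
  have 0: "fps_nth (F ^ k) 0 = 1" for k using assms by (simp add: fps_power_zeroth)
  show 1: "fps_nth (F ^ k) 1 = of_nat k * fps_nth F 1" for k
    by (induction k) (simp_all add: fps_mult_nth 0 assms algebra_simps)
  show "fps_nth (F ^ k) 2 = of_nat k * fps_nth F 2 + of_nat k * (of_nat k - 1) / 2 * fps_nth F 1 ^ 2"
    by (induction k)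
       (use 1 in \<open>simp_all add: fps_mult_nth 0 assms field_simps eval_nat_numeral\<close>)
qed

lemma fps_log_divide:
  fixes F G :: "'a::field_char_0 fps"
  assumes "fps_nth F 0 \<noteq> 0" "fps_nth G 0 \<noteq> 0"
  shows "fps_log (F / G) = fps_log F - fps_log G"
  using assms by (simp add: fps_divide_unit fps_log_mult fps_log_inverse)

lemma fps_log_nth_gap:
  fixes F :: "'a::field_char_0 fps"
  assumes "\<And>i. 0 < i \<Longrightarrow> i \<le> N \<Longrightarrow> fps_nth F i = 0" and "k \<le> N"
  shows "fps_nth (fps_log F) k = 0"
proof (cases k)
  case (Suc j)
  have "fps_nth (fps_deriv F * inverse F) j = 0"
    unfolding fps_mult_nth using assms Suc by (intro sum.neutral) auto
  with Suc show ?thesis by (simp add: fps_log_def)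
qed simp

section \<open>Euler's product as a power series\<close>

text \<open>
  The tails of Euler's product are treated along with the product itself, because the
  coefficients of the product are found by splitting off finitely many factors and showing
  that the remaining tail is \<open>1 + O(q\<^sup>N\<^sup>+\<^sup>1)\<close>.
\<close>
definition euler_tail :: "nat \<Rightarrow> complex \<Rightarrow> complex" where
  "euler_tail N q = (\<Prod>k. 1 - q ^ Suc (k + N))"

lemma convergent_euler_tail:
  assumes "norm q < 1"
  shows "convergent_prod (\<lambda>k. 1 - q ^ Suc (k + N) :: complex)"
proof -
  have "summable (\<lambda>k. norm q ^ Suc N * norm q ^ k)"
    using assms by (intro summable_mult summable_geometric) auto
  then have "summable (\<lambda>k. norm (- (q ^ Suc (k + N))))"
    by (simp add: norm_power norm_mult power_add mult_ac)
  then have "convergent_prod (\<lambda>k. 1 + - (q ^ Suc (k + N)))"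
    by (intro abs_convergent_prod_imp_convergent_prod summable_imp_abs_convergent_prod)
       (simp add: norm_power)
  then show ?thesis by simp
qed

lemma euler_tail_LIMSEQ:
  assumes "norm q < 1"
  shows "(\<lambda>M. \<Prod>k<M. 1 - q ^ Suc (k + N)) \<longlonglongrightarrow> euler_tail N q"
  using convergent_prod_LIMSEQ[OF convergent_euler_tail[OF assms, of N]]
  unfolding euler_tail_def by (subst (asm) LIMSEQ_lessThan_iff_atMost[symmetric])

lemma euler_tail_split:
  assumes "norm q < 1"
  shows "euler_tail 0 q = (\<Prod>k<N. 1 - q ^ Suc k) * euler_tail N q"
proof -
  have "1 - q ^ Suc i \<noteq> 0" for i
  proof
    assume "1 - q ^ Suc i = 0"
    then have "norm q ^ Suc i = 1" by (metis eq_iff_diff_eq_0 norm_one norm_power)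
    moreover have "norm q ^ Suc i \<le> norm q"
      using power_decreasing[of 1 "Suc i" "norm q"] assms by simp
    ultimately show False using assms by simp
  qed
  with prodinf_split_initial_segment[of "\<lambda>k. 1 - q ^ Suc k" N] convergent_euler_tail[OF assms, of 0]
  show ?thesis by (simp add: euler_tail_def mult.commute)
qed

text \<open>
  The finite products satisfy \<open>\<bar>\<Prod>(1 - c\<^sub>k) - 1\<bar> \<le> exp (\<Sum>\<bar>c\<^sub>k\<bar>) - 1\<close>, and here the
  geometric sum of the \<open>\<bar>c\<^sub>k\<bar>\<close> is at most \<open>2 \<bar>q\<bar>\<^sup>N\<^sup>+\<^sup>1 \<le> 1/2\<close>.
\<close>
lemma euler_tail_near_1:
  assumes "norm q \<le> 1 / 4"
  shows "norm (euler_tail N q - 1) \<le> 4 * norm q ^ Suc N"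
proof (rule LIMSEQ_le_const2)
  show "(\<lambda>M. norm ((\<Prod>k<M. 1 - q ^ Suc (k + N)) - 1)) \<longlonglongrightarrow> norm (euler_tail N q - 1)"
    using assms by (intro tendsto_intros euler_tail_LIMSEQ) auto
  have small: "2 * norm q ^ Suc N \<le> 1 / 2"
  proof -
    have "norm q ^ Suc N \<le> norm q ^ 1"
      using assms by (intro power_decreasing) auto
    with assms show ?thesis by simp
  qed
  have "norm ((\<Prod>k<M. 1 - q ^ Suc (k + N)) - 1) \<le> 4 * norm q ^ Suc N" for M
  proof -
    have "norm ((\<Prod>k<M. 1 + - (q ^ Suc (k + N))) - 1)
        \<le> (\<Prod>k<M. 1 + norm (- (q ^ Suc (k + N)))) - 1"
      by (rule norm_prod_minus1_le_prod_minus1)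
    also have "(\<Prod>k<M. 1 + norm (- (q ^ Suc (k + N)))) \<le> exp (\<Sum>k<M. norm (- (q ^ Suc (k + N))))"
      by (rule prod_le_exp_sum) auto
    also have "(\<Sum>k<M. norm (- (q ^ Suc (k + N)))) = norm q ^ Suc N * (\<Sum>k<M. norm q ^ k)"
      by (simp add: norm_power norm_mult power_add sum_distrib_left mult_ac)
    also have "(\<Sum>k<M. norm q ^ k) \<le> (\<Sum>k. norm q ^ k)"
      using assms by (intro sum_le_suminf summable_geometric) auto
    also have "(\<Sum>k. norm q ^ k) = 1 / (1 - norm q)"
      using assms by (intro suminf_geometric) auto
    also have "\<dots> \<le> 2"
      using assms by (simp add: field_simps)
    also have "exp (norm q ^ Suc N * 2) \<le> 1 + 2 * (norm q ^ Suc N * 2)"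
      using small by (intro real_exp_bound_lemma) (auto simp: mult.commute)
    finally show ?thesis by (simp add: mult_left_mono)
  qed
  then show "\<exists>K. \<forall>M\<ge>K. norm ((\<Prod>k<M. 1 - q ^ Suc (k + N)) - 1) \<le> 4 * norm q ^ Suc N"
    by blast
qed

text \<open>By the Weierstrass test the finite products converge uniformly on the disc of radius 1/2.\<close>
lemma euler_tail_analytic: "euler_tail N analytic_on {0}"
proof -
  let ?P = "\<lambda>M q. \<Prod>k<M. 1 - q ^ Suc (k + N) :: complex"
  have "uniformly_convergent_on (cball 0 (1/2)) (\<lambda>M q. \<Sum>k<M. norm (1 - q ^ Suc (k + N) - 1 :: complex))"
  proof (rule Weierstrass_m_test'[where M = "\<lambda>k. (1/2) ^ Suc (k + N)"])
    show "summable (\<lambda>k. (1/2) ^ Suc (k + N) :: real)"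
      by (intro summable_ignore_initial_segment[of "\<lambda>k. (1/2) ^ Suc k"])
         (simp add: summable_geometric)
    show "norm (norm (1 - q ^ Suc (k + N) - 1)) \<le> (1/2) ^ Suc (k + N)" if "q \<in> cball 0 (1/2)" for k and q :: complex
    proof -
      have "norm q ^ Suc (k + N) \<le> (1/2) ^ Suc (k + N)"
        using that by (intro power_mono) auto
      then show ?thesis by (simp add: norm_power norm_mult)
    qed
  qed
  then have "uniformly_convergent_on (cball 0 (1/2)) ?P"
    by (intro uniformly_convergent_on_prod') (auto intro!: continuous_intros)
  then obtain g where g: "uniform_limit (cball 0 (1/2)) ?P g sequentially"
    by (auto simp: uniformly_convergent_on_def)
  have "g q = euler_tail N q" if "q \<in> cball 0 (1/2)" for q
    using tendsto_uniform_limitI[OF g that] euler_tail_LIMSEQ[of q N] that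
    by (intro LIMSEQ_unique[of "\<lambda>M. ?P M q"]) auto
  then have lim: "uniform_limit (cball 0 (1/2)) ?P (euler_tail N) sequentially"
    using g uniform_limit_cong'[of "cball 0 (1/2)" ?P ?P g "euler_tail N" sequentially] by auto
  have "euler_tail N holomorphic_on ball 0 (1/2)"
  proof (rule holomorphic_uniform_limit[THEN conjunct2])
    show "\<forall>\<^sub>F M in sequentially. continuous_on (cball 0 (1/2)) (?P M) \<and> ?P M holomorphic_on ball 0 (1/2)"
      by (intro always_eventually allI conjI continuous_intros holomorphic_intros)
  qed (use lim in auto)
  then show ?thesis
    by (intro analytic_on_subset[of _ "ball 0 (1/2)" "{0}"]) (auto simp: analytic_on_open)
qed

definition euler_fps :: "nat \<Rightarrow> complex fps" where
  "euler_fps N = fps_expansion (euler_tail N) 0"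

lemma euler_tail_has_fps_expansion: "euler_tail N has_fps_expansion euler_fps N"
  unfolding euler_fps_def by (rule analytic_at_imp_has_fps_expansion_0) (rule euler_tail_analytic)

text \<open>Near 0 a function is asymptotic to the leading term of its expansion.\<close>
lemma has_fps_expansion_small_imp_nth_0:
  fixes f :: "complex \<Rightarrow> complex"
  assumes F: "f has_fps_expansion F" and O: "f \<in> O[at 0](\<lambda>z. z ^ N)" and k: "k < N"
  shows "fps_nth F k = 0"
proof (cases "F = 0")
  case False
  define d where "d = subdegree F"
  define c where "c = fps_nth F d"
  have c: "c \<noteq> 0" using False by (simp add: c_def d_def)
  have "f \<sim>[at 0] (\<lambda>z. c * z ^ d)"
    using has_fps_expansion_imp_asymp_equiv_0[OF F] 
    by (simp add: asymp_equiv_nhds_iff c_def d_def)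
  then have "(\<lambda>z. c * z ^ d) \<in> O[at 0](f)"
    by (rule asymp_equiv_imp_bigo[OF asymp_equiv_symI])
  also note O
  finally have "(\<lambda>z::complex. z ^ d) \<in> O[at 0](\<lambda>z. z ^ N)" using c by simp
  then obtain C where C: "C > 0" "\<forall>\<^sub>F z::complex in at 0. norm (z ^ d) \<le> C * norm (z ^ N)"
    by (auto elim: landau_o.bigE)
  have "N \<le> d"
  proof (rule ccontr)
    assume "\<not> N \<le> d"
    then obtain e where e: "N = d + Suc e" by (metis not_le less_iff_Suc_add add_Suc_right)
    have "\<forall>\<^sub>F z::complex in at 0. 1 \<le> C * norm (z ^ Suc e)"
      using C(2) eventually_neq_at_within[of 0]
      by eventually_elim (auto simp: e power_add norm_mult norm_power)
    moreover have "((\<lambda>z::complex. C * norm (z ^ Suc e)) \<longlongrightarrow> C * norm ((0::complex) ^ Suc e)) (at 0)"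
      by (intro tendsto_intros)
    ultimately have "1 \<le> C * norm ((0::complex) ^ Suc e)"
      by (intro tendsto_lowerbound) auto
    then show False by simp
  qed
  with k show ?thesis unfolding d_def by (intro nth_less_subdegree_zero) simp
qed simp

lemma euler_fps_nth_0 [simp]: "fps_nth (euler_fps N) 0 = 1"
  and euler_fps_nth_gap: "0 < k \<Longrightarrow> k \<le> N \<Longrightarrow> fps_nth (euler_fps N) k = 0"
proof -
  have "(\<lambda>q. euler_tail N q - 1) has_fps_expansion euler_fps N - 1"
    by (intro fps_expansion_intros euler_tail_has_fps_expansion)
  moreover have "(\<lambda>q. euler_tail N q - 1) \<in> O[at 0](\<lambda>q. q ^ Suc N)"
  proof (rule landau_o.bigI)
    have "\<forall>\<^sub>F q in at 0. norm q < 1 / 4"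
      by (intro order_tendstoD tendsto_eq_intros) (auto simp: tendsto_norm_zero)
    then show "\<forall>\<^sub>F q in at 0. norm (euler_tail N q - 1) \<le> 4 * norm (q ^ Suc N)"
      by eventually_elim (metis euler_tail_near_1 less_imp_le norm_power)
  qed simp
  ultimately have *: "fps_nth (euler_fps N - 1) k = 0" if "k \<le> N" for k
    using has_fps_expansion_small_imp_nth_0 that by (metis le_imp_less_Suc)
  show "fps_nth (euler_fps N) 0 = 1" using *[of 0] by simp
  show "0 < k \<Longrightarrow> k \<le> N \<Longrightarrow> fps_nth (euler_fps N) k = 0" using *[of k] by simp
qed

lemma euler_fps_split:
  "euler_fps 0 = (\<Prod>k<N. 1 - fps_X ^ Suc k) * euler_fps N"
proof (rule fps_expansion_unique_complex)
  have expansion: "(\<lambda>q. (\<Prod>k<N. 1 - q ^ Suc k) * euler_tail N q) has_fps_expansion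
          (\<Prod>k<N. 1 - fps_X ^ Suc k) * euler_fps N"
    by (intro fps_expansion_intros euler_tail_has_fps_expansion)
  have "\<forall>\<^sub>F q in nhds 0. norm (q :: complex) < 1"
    using eventually_nhds_in_open[of "ball 0 1" "0::complex"] by (simp add: dist_norm)
  then have "\<forall>\<^sub>F q in nhds 0. (\<Prod>k<N. 1 - q ^ Suc k) * euler_tail N q = euler_tail 0 q"
    by eventually_elim (rule euler_tail_split [symmetric])
  from this and expansion
  show "euler_tail 0 has_fps_expansion (\<Prod>k<N. 1 - fps_X ^ Suc k) * euler_fps N"
    by (rule iffD1[OF has_fps_expansion_cong[OF _ refl]])
qed (rule euler_tail_has_fps_expansion)

text \<open>
  The classical identity \<open>log \<Prod>(1 - q\<^sup>r) = - \<Sum> \<sigma>\<^sub>1(k) q\<^sup>k / k\<close>: the factor \<open>1 - q\<^sup>r\<close>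
  contributes \<open>- r / k\<close> to the coefficient of \<open>q\<^sup>k\<close> when \<open>r\<close> divides \<open>k\<close>, and the factors
  with \<open>r > k\<close> contribute nothing.
\<close>
lemma fps_log_euler_nth:
  "fps_nth (fps_log (euler_fps 0)) k = - of_nat (sigma1 k) / of_nat k"
proof (cases "k = 0")
  case False
  have factor: "fps_nth (fps_log (1 - fps_X ^ r :: complex fps)) k = (if r dvd k then - of_nat r / of_nat k else 0)"
    if "r > 0" for r
  proof -
    have "(1 - fps_X ^ r :: complex fps) = (1 - fps_X) oo fps_X ^ r"
      using that by (simp add: fps_compose_sub_distrib)
    then have "fps_log (1 - fps_X ^ r :: complex fps) = fps_log (1 - fps_X) oo fps_X ^ r"
      using that by (simp add: fps_log_compose)
    then show ?thesis
      using that False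
      by (auto simp: fps_nth_compose_X_power fps_log_one_minus_X_nth elim!: dvdE)
  qed
  have "fps_nth (fps_log (euler_fps 0)) k = (\<Sum>j<k. fps_nth (fps_log (1 - fps_X ^ Suc j :: complex fps)) k)"
  proof -
    have "fps_nth (\<Prod>j<k. 1 - fps_X ^ Suc j :: complex fps) 0 \<noteq> 0"
      by (induction k) auto
    then have "fps_log (euler_fps 0)
        = fps_log (\<Prod>j<k. 1 - fps_X ^ Suc j) + fps_log (euler_fps k)"
      by (subst euler_fps_split[of k], subst fps_log_mult) simp_all
    also have "fps_log (\<Prod>j<k. 1 - fps_X ^ Suc j) = (\<Sum>j<k. fps_log (1 - fps_X ^ Suc j :: complex fps))"
      by (rule fps_log_prod) simp
    finally have "fps_log (euler_fps 0)
        = (\<Sum>j<k. fps_log (1 - fps_X ^ Suc j)) + fps_log (euler_fps k)" .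
    then show ?thesis
      by (simp add: fps_sum_nth fps_log_nth_gap[of k "euler_fps k"] euler_fps_nth_gap del: power_Suc)
  qed
  also have "\<dots> = (\<Sum>j<k. if Suc j dvd k then - of_nat (Suc j) / of_nat k else 0)"
    by (simp only: factor zero_less_Suc)
  also have "\<dots> = (\<Sum>j | j < k \<and> Suc j dvd k. - of_nat (Suc j) / of_nat k)"
    by (intro sum.mono_neutral_cong_right) auto
  also have "\<dots> = (\<Sum>d | d dvd k. - of_nat d / of_nat k)"
    using False by (intro sum.reindex_bij_witness[of _ "\<lambda>d. d - 1" Suc])
      (auto dest: dvd_imp_le dvd_pos_nat intro: Suc_le_lessD)
  also have "\<dots> = - of_nat (sigma1 k) / of_nat k"
    by (simp add: sigma1_def sum_negf sum_divide_distrib)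
  finally show ?thesis .
qed simp

section \<open>Expansions of the modular functions at the cusp\<close>

text \<open>
  \<open>X\<close> and \<open>Y\<close> are built from these quotients, with \<open>r = 1\<close> and \<open>r = p\<close>: the exponents
  \<open>u, v\<close> are \<open>n, 2n\<close> for \<open>X\<close> and \<open>2n, n\<close> for \<open>Y\<close>.
\<close>
definition theta_quotient :: "nat \<Rightarrow> nat \<Rightarrow> nat \<Rightarrow> complex \<Rightarrow> complex" where
  "theta_quotient u v r q = euler_tail 0 (q ^ r) ^ u * euler_tail 0 (q ^ (4 * r)) ^ v
     / euler_tail 0 (q ^ (2 * r)) ^ (u + v)"

definition theta_quotient_fps :: "nat \<Rightarrow> nat \<Rightarrow> nat \<Rightarrow> complex fps" where
  "theta_quotient_fps u v r = (euler_fps 0 oo fps_X ^ r) ^ u * (euler_fps 0 oo fps_X ^ (4 * r)) ^ v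
     / (euler_fps 0 oo fps_X ^ (2 * r)) ^ (u + v)"

lemma theta_quotient_has_fps_expansion:
  assumes "r > 0"
  shows "theta_quotient u v r has_fps_expansion theta_quotient_fps u v r"
proof -
  have "(\<lambda>q. euler_tail 0 (q ^ s)) has_fps_expansion (euler_fps 0 oo fps_X ^ s)" if "s > 0" for s
  proof -
    have "(euler_tail 0 \<circ> (\<lambda>q. q ^ s)) has_fps_expansion (euler_fps 0 oo fps_X ^ s)"
      using that by (intro has_fps_expansion_compose euler_tail_has_fps_expansion fps_expansion_intros) auto
    then show ?thesis by (simp add: o_def)
  qed
  then show ?thesis
    unfolding theta_quotient_def theta_quotient_fps_def using assms
    by (intro has_fps_expansion_divide' fps_expansion_intros) (simp_all add: fps_power_zeroth)
qed

lemma theta_quotient_fps_nth_0 [simp]: "fps_nth (theta_quotient_fps u v r) 0 = 1"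
  by (simp add: theta_quotient_fps_def fps_power_zeroth fps_divide_unit)

text \<open>
  The convention that \<open>\<sigma>\<^sub>1(x) / x\<close> is 0 off the positive integers matches the substitution
  of \<open>q\<^sup>r\<close> for \<open>q\<close>, which produces only exponents divisible by \<open>r\<close>.
\<close>
lemma sigma1_ratio_div:
  assumes "r > 0"
  shows "sigma1_ratio (real k / real r) = (if r dvd k then real (sigma1 (k div r)) / real (k div r) else 0)"
proof (cases "r dvd k")
  case True
  then obtain j where "k = r * j" by auto
  then show ?thesis using assms by (auto simp: sigma1_ratio_def)
next
  case False
  have "real k / real r \<notin> \<int>"
  proof
    assume "real k / real r \<in> \<int>"
    then obtain z where "real k / real r = of_int z" by (auto elim: Ints_cases)
    then have "real_of_int (int k) = real_of_int (int r * z)" using assms by (simp add: field_simps)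
    then have "int k = int r * z" by (simp only: of_int_eq_iff)
    then have "int r dvd int k" by simp
    with False show False by simp
  qed
  then show ?thesis using False by (simp add: sigma1_ratio_def)
qed

lemma fps_log_theta_quotient_nth:
  assumes "r > 0"
  shows "fps_nth (fps_log (theta_quotient_fps u v r)) k = - of_real
     (real u * sigma1_ratio (real k / real r) - real (u + v) * sigma1_ratio (real k / (2 * real r))
       + real v * sigma1_ratio (real k / (4 * real r)))"
proof -
  have *: "fps_nth (fps_log (euler_fps 0 oo fps_X ^ s)) k = - of_real (sigma1_ratio (real k / real s))"
    if "s > 0" for s
    using that
    by (simp add: fps_log_compose fps_nth_compose_X_power sigma1_ratio_div fps_log_euler_nth)
  have nz: "fps_nth ((euler_fps 0 oo fps_X ^ s) ^ w) 0 \<noteq> 0" for s w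
    by (simp add: fps_power_zeroth)
  have "fps_log (theta_quotient_fps u v r) = of_nat u * fps_log (euler_fps 0 oo fps_X ^ r)
      + of_nat v * fps_log (euler_fps 0 oo fps_X ^ (4 * r))
      - of_nat (u + v) * fps_log (euler_fps 0 oo fps_X ^ (2 * r))"
    unfolding theta_quotient_fps_def using nz
    by (simp add: fps_log_divide fps_log_mult fps_log_power del: of_nat_add)
  then show ?thesis
    using *[of r] *[of "2 * r"] *[of "4 * r"] assms
    by (simp add: fps_of_nat [symmetric] del: of_nat_add)
qed

text \<open>The expansion of \<open>X\<close> without its factor \<open>2\<^sup>n q\<^sup>m\<close>.\<close>
definition modX_fps :: "nat \<Rightarrow> nat \<Rightarrow> complex fps" where
  "modX_fps p n = theta_quotient_fps n (2 * n) 1 * theta_quotient_fps n (2 * n) p"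

definition modY_fps :: "nat \<Rightarrow> nat \<Rightarrow> complex fps" where
  "modY_fps p n = theta_quotient_fps (2 * n) n 1 * theta_quotient_fps (2 * n) n p"

lemma modX_fps_nth_0 [simp]: "fps_nth (modX_fps p n) 0 = 1"
  and modY_fps_nth_0 [simp]: "fps_nth (modY_fps p n) 0 = 1"
  by (simp_all add: modX_fps_def modY_fps_def)

lemma Qprod_eq_euler_tail: "Qprod (of_nat r * \<tau>) = euler_tail 0 (nome \<tau> ^ r)"
proof -
  have "nome (of_nat r * \<tau>) = nome \<tau> ^ r"
    by (simp add: nome_def exp_of_nat_mult [symmetric] mult_ac)
  then show ?thesis by (simp add: Qprod_def euler_tail_def)
qed

lemma modX_eq: "modX p m n \<tau> = 2 ^ n * nome \<tau> ^ m *
    (theta_quotient n (2 * n) 1 (nome \<tau>) * theta_quotient n (2 * n) p (nome \<tau>))"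
  and modY_eq: "modY p n \<tau> =
    theta_quotient (2 * n) n 1 (nome \<tau>) * theta_quotient (2 * n) n p (nome \<tau>)"
  using Qprod_eq_euler_tail[of 1 \<tau>] Qprod_eq_euler_tail[of 2 \<tau>] Qprod_eq_euler_tail[of 4 \<tau>]
    Qprod_eq_euler_tail[of p \<tau>] Qprod_eq_euler_tail[of "2 * p" \<tau>] Qprod_eq_euler_tail[of "4 * p" \<tau>]
  by (simp_all add: modX_def modY_def theta_quotient_def)

lemma nome_surj:
  assumes "q \<noteq> 0" "norm q < 1"
  obtains \<tau> where "Im \<tau> > 0" "nome \<tau> = q"
proof
  define \<tau> where "\<tau> = Ln q / (\<i> * of_real pi)"
  have "\<i> * of_real pi * \<tau> = Ln q" by (simp add: \<tau>_def)
  then show "nome \<tau> = q" using assms by (simp add: nome_def)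
  have "pi * Im \<tau> = - ln (norm q)"
    using assms(1) by (simp add: \<tau>_def Im_divide power2_eq_square)
  also have "\<dots> > 0" using assms by simp
  finally show "Im \<tau> > 0" by (simp add: zero_less_mult_iff)
qed

text \<open>
  Every \<open>q\<close> in the punctured unit disc is a nome, so the left side of the relation, as a
  function of \<open>q\<close>, vanishes on a punctured neighbourhood of 0 and is a fortiori
  \<open>O(q\<^sup>N)\<close> for every \<open>N\<close>.
\<close>
lemma modular_relation_fps:
  assumes "is_modular_matrix p m n a" "p > 0"
  shows "(\<Sum>i=0..m. \<Sum>h=0..m. of_int (a i h)
    * (fps_X ^ m * (fps_const (2 ^ n) * modX_fps p n)) ^ i * modY_fps p n ^ h) = 0" (is "?F = 0")
proof -
  define H where "H q = (\<Sum>i=0..m. \<Sum>h=0..m. of_int (a i h)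
    * (q ^ m * (2 ^ n * (theta_quotient n (2 * n) 1 q * theta_quotient n (2 * n) p q))) ^ i
    * (theta_quotient (2 * n) n 1 q * theta_quotient (2 * n) n p q) ^ h)" for q
  have "H has_fps_expansion ?F"
    unfolding H_def [abs_def] modX_fps_def modY_fps_def fps_of_int [symmetric]
    using \<open>p > 0\<close> by (intro fps_expansion_intros theta_quotient_has_fps_expansion) auto
  moreover have "H \<in> O[at 0](\<lambda>q. q ^ N)" for N
  proof (rule landau_o.bigI[of 1])
    have "\<forall>\<^sub>F q::complex in at 0. q \<noteq> 0 \<and> norm q < 1"
      using eventually_at_ball[of 1 "0 :: complex" UNIV] eventually_neq_at_within[of 0]
      by (auto simp: eventually_conj_iff)
    then show "\<forall>\<^sub>F q in at 0. norm (H q) \<le> 1 * norm (q ^ N)"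
    proof eventually_elim
      case (elim q)
      then obtain \<tau> where \<tau>: "Im \<tau> > 0" "nome \<tau> = q" using nome_surj by blast
      have "H q = (\<Sum>i=0..m. \<Sum>h=0..m. of_int (a i h) * modX p m n \<tau> ^ i * modY p n \<tau> ^ h)"
        by (simp add: H_def modX_eq modY_eq \<tau> mult_ac)
      also have "\<dots> = 0" using assms \<tau> unfolding is_modular_matrix_def by blast
      finally show ?case by simp
    qed
  qed simp
  ultimately have "fps_nth ?F k = 0" for k
    using has_fps_expansion_small_imp_nth_0[of H ?F "Suc k" k] by blast
  then show ?thesis by (simp add: fps_eq_iff)
qed

lemma fps_log_modX_nth:
  assumes "p > 0"
  shows "fps_nth (fps_log (modX_fps p n)) k = - (of_nat n * of_real (alpha p k))"
  using assms
  by (simp add: modX_fps_def fps_log_mult fps_log_theta_quotient_nth alpha_def algebra_simps)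

lemma sigma1_ratio_half_multiple:
  assumes "odd k" "r > 0"
  shows "sigma1_ratio (real k / (2 * real r)) = 0" "sigma1_ratio (real k / (4 * real r)) = 0"
proof -
  have "\<not> 2 * r dvd k" "\<not> 4 * r dvd k"
    using assms(1) by (auto elim!: dvdE)
  then show "sigma1_ratio (real k / (2 * real r)) = 0" "sigma1_ratio (real k / (4 * real r)) = 0"
    using assms(2) sigma1_ratio_div[of "2 * r" k] sigma1_ratio_div[of "4 * r" k] by simp_all
qed

text \<open>
  For odd \<open>k\<close> only the terms \<open>\<sigma>\<^sub>1(k)/k\<close> and \<open>\<sigma>\<^sub>1(k/p)/(k/p)\<close> survive in \<open>\<alpha>(k)\<close>; they come
  from the factors \<open>Q(\<tau>)\<close> and \<open>Q(p \<tau>)\<close>, whose exponents in \<open>Y\<close> are twice those in \<open>X\<close>.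
\<close>
lemma fps_log_modY_nth_odd:
  assumes "p > 0" "odd k"
  shows "fps_nth (fps_log (modY_fps p n)) k = - 2 * of_nat n * of_real (alpha p k)"
  using assms sigma1_ratio_half_multiple[of k 1] sigma1_ratio_half_multiple[of k p]
  by (simp add: modY_fps_def fps_log_mult fps_log_theta_quotient_nth alpha_def algebra_simps)

lemma sigma1_1: "sigma1 1 = 1"
  by (simp add: sigma1_def)

lemma sigma1_prime:
  assumes "prime p"
  shows "sigma1 p = p + 1"
proof -
  have "{d. d dvd p} = {1, p}" using assms by (auto simp: prime_nat_iff)
  then show ?thesis using prime_gt_1_nat[OF assms] by (simp add: sigma1_def)
qed

lemma sigma1_ratio_of_nat: "k > 0 \<Longrightarrow> sigma1_ratio (real k) = real (sigma1 k) / real k"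
  using sigma1_ratio_div[of 1 k] by simp

lemma sigma1_ratio_eq_0:
  assumes "0 < k" "k < r"
  shows "sigma1_ratio (real k / real r) = 0"
  using assms sigma1_ratio_div[of r k] by (auto dest: dvd_imp_le)

text \<open>
  The vanishing coefficient of \<open>q\<^sup>2\<close> in \<open>log Y\<close> is the cancellation
  \<open>2 \<sigma>\<^sub>1(2) / 2 - 3 \<sigma>\<^sub>1(1) = 0\<close>; it reflects that \<open>1 - \<lambda> = (\<theta>\<^sub>4 / \<theta>\<^sub>3)\<^sup>4\<close> is inverted
  by \<open>q \<mapsto> - q\<close>.
\<close>
lemma low_order_log_coefficients:
  assumes "p \<ge> 3"
  shows "alpha p 1 = 1" "alpha p 2 = - 3 / 2"
    "alpha p 3 = 4 / 3 + (if p = 3 then 1 else 0)"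
    "fps_nth (fps_log (modY_fps p n)) 2 = 0"
proof -
  have s: "sigma1 1 = 1" "sigma1 2 = 3" "sigma1 3 = 4"
    using sigma1_prime[of 2] sigma1_prime[of 3] sigma1_1 by simp_all
  have z: "sigma1_ratio (real k / real p) = 0" "sigma1_ratio (real k / (2 * real p)) = 0"
    "sigma1_ratio (real k / (4 * real p)) = 0" if "0 < k" "k < p" for k
    using that sigma1_ratio_eq_0[of k p] sigma1_ratio_eq_0[of k "2 * p"] sigma1_ratio_eq_0[of k "4 * p"]
    by simp_all
  have r: "sigma1_ratio 1 = 1" "sigma1_ratio 2 = 3 / 2" "sigma1_ratio 3 = 4 / 3"
    "sigma1_ratio (1 / 2) = 0" "sigma1_ratio (1 / 4) = 0" "sigma1_ratio (2 / 4) = 0"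
    using sigma1_ratio_of_nat[of 1] sigma1_ratio_of_nat[of 2] sigma1_ratio_of_nat[of 3] s
      sigma1_ratio_eq_0[of 1 2] sigma1_ratio_eq_0[of 1 4] sigma1_ratio_eq_0[of 2 4]
    by simp_all
  show "alpha p 1 = 1" using z[of 1] r assms by (simp add: alpha_def)
  show "alpha p 2 = - 3 / 2" using z[of 2] r assms by (simp add: alpha_def)
  show "fps_nth (fps_log (modY_fps p n)) 2 = 0"
    using z[of 2] assms
    by (simp add: modY_fps_def fps_log_mult fps_log_theta_quotient_nth r)
  have "sigma1_ratio (3 / real p) = (if p = 3 then 1 else 0)"
    using z[of 3] r assms by auto
  then show "alpha p 3 = 4 / 3 + (if p = 3 then 1 else 0)"
    using r sigma1_ratio_half_multiple[of 3 1] sigma1_ratio_half_multiple[of 3 p] assms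
    by (simp add: alpha_def)
qed

section \<open>The first two rows of the matrix\<close>

text \<open>
  The expansion holds in every commutative ring; it is needed for power series and for the
  integers, with the same coefficients.
\<close>
lemma polynomial_expand_at_1:
  fixes z :: "'a::comm_ring_1" and b :: "nat \<Rightarrow> int"
  shows "(\<Sum>h=0..m. of_int (b h) * z ^ h)
    = (\<Sum>k=0..m. of_int (\<Sum>h=0..m. b h * int (h choose k)) * (z - 1) ^ k)"
proof -
  have "z ^ h = (\<Sum>k=0..m. of_nat (h choose k) * (z - 1) ^ k)" if "h \<le> m" for h
  proof -
    have "z ^ h = ((z - 1) + 1) ^ h" by simp
    also have "\<dots> = (\<Sum>k\<le>h. of_nat (h choose k) * (z - 1) ^ k)"
      by (subst binomial_ring) simp
    also have "\<dots> = (\<Sum>k=0..m. of_nat (h choose k) * (z - 1) ^ k)"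
      using that by (intro sum.mono_neutral_left) (auto simp: binomial_eq_0)
    finally show ?thesis .
  qed
  then have "(\<Sum>h=0..m. of_int (b h) * z ^ h)
      = (\<Sum>h=0..m. \<Sum>k=0..m. of_int (b h) * (of_nat (h choose k) * (z - 1) ^ k))"
    by (simp add: sum_distrib_left)
  also have "\<dots> = (\<Sum>k=0..m. \<Sum>h=0..m. of_int (b h) * (of_nat (h choose k) * (z - 1) ^ k))"
    by (rule sum.swap)
  finally show ?thesis
    by (simp add: sum_distrib_right mult.assoc)
qed

text \<open>
  Since \<open>y - 1\<close> has a simple zero, a polynomial in \<open>y\<close> vanishes as a series to the same order
  as the polynomial does at 1. Degree \<open>m\<close> and order \<open>m\<close> leave only a multiple of
  \<open>(1 - y)\<^sup>m\<close>; the multiple is found by evaluating the polynomial at 0.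
\<close>
lemma polynomial_vanishing_to_full_order:
  fixes y :: "'a::{idom,ring_char_0} fps" and b :: "nat \<Rightarrow> int"
  assumes "fps_nth y 0 = 1" "fps_nth y 1 \<noteq> 0"
    and vanish: "\<And>k. k < m \<Longrightarrow> fps_nth (\<Sum>h=0..m. of_int (b h) * y ^ h) k = 0"
  shows "(\<Sum>h=0..m. of_int (b h) * y ^ h) = of_int (b 0) * (1 - y) ^ m"
proof -
  define c where "c k = (\<Sum>h=0..m. b h * int (h choose k))" for k
  define V where "V = fps_shift 1 (y - 1)"
  have expand: "(\<Sum>h=0..m. of_int (b h) * z ^ h) = (\<Sum>k=0..m. of_int (c k) * (z - 1) ^ k)"
    for z :: "'c::comm_ring_1"
    unfolding c_def by (rule polynomial_expand_at_1)
  have V0: "fps_nth V 0 \<noteq> 0" using assms by (simp add: V_def)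
  have W: "y - 1 = fps_X * V"
    using assms by (intro fps_ext) (simp add: V_def fps_X_mult_nth)
  have nth_c: "fps_nth (of_int i * F) k = of_int i * fps_nth F k" for i k and F :: "'a fps"
    by (simp add: fps_of_int [symmetric])
  have c0: "c k = 0" if "k < m" for k
    using that
  proof (induction k rule: less_induct)
    case (less k)
    have "0 = fps_nth (\<Sum>j=0..m. of_int (c j) * (y - 1) ^ j) k"
      using vanish[OF less.prems] unfolding expand[of y] by simp
    also have "\<dots> = (\<Sum>j=0..m. of_int (c j) * fps_nth (fps_X ^ j * V ^ j) k)"
      by (simp only: fps_sum_nth nth_c W power_mult_distrib)
    also have "\<dots> = (\<Sum>j=0..m. if j = k then of_int (c j) * fps_nth V 0 ^ k else 0)"
      using less by (intro sum.cong) (auto simp: fps_X_power_mult_nth fps_power_zeroth)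
    also have "\<dots> = of_int (c k) * fps_nth V 0 ^ k"
      using less.prems by simp
    finally show ?case using V0 by simp
  qed
  have last: "(\<Sum>h=0..m. of_int (b h) * z ^ h) = of_int (c m) * (z - 1) ^ m" for z :: "'c::comm_ring_1"
  proof -
    have "(\<Sum>k=0..m. of_int (c k) * (z - 1) ^ k) = (\<Sum>k\<in>{m}. of_int (c k) * (z - 1) ^ k)"
      using c0 by (intro sum.mono_neutral_right) auto
    then show ?thesis unfolding expand[of z] by simp
  qed
  have "(\<Sum>h=0..m. b h * 0 ^ h) = c m * (- 1) ^ m"
    using last[of "0 :: int"] by simp
  then have "b 0 = c m * (- 1) ^ m"
    by (simp add: sum.atLeast_Suc_atMost power_0_left)
  moreover have "(1 - y) ^ m = (- 1) ^ m * (y - 1) ^ m"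
    by (simp flip: power_mult_distrib)
  ultimately have "of_int (b 0) * (1 - y) ^ m = of_int (c m) * ((- 1) ^ m * (- 1) ^ m) * (y - 1) ^ m"
    by (simp only: of_int_mult of_int_power of_int_minus of_int_1 mult_ac)
  also have "(- 1 :: 'a fps) ^ m * (- 1) ^ m = 1"
    by (simp flip: power_mult_distrib)
  finally show ?thesis
    using last[of y] by simp
qed

text \<open>
  Modulo \<open>q\<^sup>m\<close> the relation sees only the row \<open>i = 0\<close>, which is therefore \<open>(1 - y)\<^sup>m\<close>;
  modulo \<open>q\<^sup>2\<^sup>m\<close> it sees the rows 0 and 1, and the common factor \<open>q\<^sup>m\<close> cancels.
\<close>
lemma second_row_from_relation:
  fixes x y :: "'a::{idom,ring_char_0} fps" and a :: "nat \<Rightarrow> nat \<Rightarrow> int"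
  assumes "m > 0" "fps_nth y 0 = 1" "fps_nth y 1 \<noteq> 0" "a 0 0 = 1"
    and rel: "(\<Sum>i=0..m. \<Sum>h=0..m. of_int (a i h) * (fps_X ^ m * x) ^ i * y ^ h) = 0"
    and "j < m"
  shows "fps_nth (x * (\<Sum>h=0..m. of_int (a 1 h) * y ^ h)) j = - fps_nth (fps_shift 1 (1 - y) ^ m) j"
proof -
  define R where "R i = (\<Sum>h=0..m. of_int (a i h) * y ^ h)" for i
  define Z where "Z = (\<Sum>i=2..m. fps_X ^ (m * (i - 2)) * x ^ i * R i)"
  have "0 = (\<Sum>i=0..m. (fps_X ^ m * x) ^ i * R i)"
    using rel by (simp add: R_def sum_distrib_left mult_ac)
  also have "\<dots> = R 0 + fps_X ^ m * x * R 1 + (\<Sum>i=2..m. (fps_X ^ m * x) ^ i * R i)"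
    using \<open>m > 0\<close> by (simp add: sum.atLeast_Suc_atMost numeral_2_eq_2)
  also have "(\<Sum>i=2..m. (fps_X ^ m * x) ^ i * R i) = fps_X ^ (2 * m) * Z"
  proof -
    have "(fps_X ^ m * x) ^ i = fps_X ^ (2 * m) * (fps_X ^ (m * (i - 2)) * x ^ i)" if "i \<in> {2..m}" for i
    proof -
      have "m * i = 2 * m + m * (i - 2)"
        using that by (auto simp: algebra_simps dest: le_Suc_ex)
      then show ?thesis
        by (simp add: power_mult_distrib mult.assoc flip: power_mult power_add)
    qed
    then show ?thesis
      unfolding Z_def sum_distrib_left by (intro sum.cong) (auto simp: mult_ac)
  qed
  also have "fps_X ^ (2 * m) = (fps_X :: 'a fps) ^ m * fps_X ^ m"
    by (simp add: mult_2 power_add)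
  finally have split: "R 0 = - (fps_X ^ m * (x * R 1 + fps_X ^ m * Z))"
    by (simp add: algebra_simps eq_neg_iff_add_eq_0)
  have "fps_nth (R 0) k = 0" if "k < m" for k
    using that unfolding split by (simp add: fps_X_power_mult_nth)
  then have "R 0 = (1 - y) ^ m"
    using polynomial_vanishing_to_full_order[of y m "a 0"] assms(2-4) by (simp add: R_def)
  also have "1 - y = fps_X * fps_shift 1 (1 - y)"
    using assms(2) by (intro fps_ext) (simp add: fps_X_mult_nth)
  finally have "fps_X ^ m * fps_shift 1 (1 - y) ^ m = fps_X ^ m * - (x * R 1 + fps_X ^ m * Z)"
    unfolding split by (simp only: power_mult_distrib mult_minus_right)
  then have "fps_shift 1 (1 - y) ^ m = - (x * R 1 + fps_X ^ m * Z)"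
    by (rule mult_left_cancel[THEN iffD1, rotated]) simp
  then show ?thesis
    using \<open>j < m\<close> by (simp add: R_def fps_X_power_mult_nth)
qed

section \<open>Comparison of the first three coefficients\<close>

text \<open>
  \<open>P\<^sub>k(m)\<close> is the coefficient of \<open>u\<^sup>k\<close> in \<open>((e\<^sup>u - 1) / u)\<^sup>m\<close>: by the binomial theorem,
  \<open>(e\<^sup>u - 1)\<^sup>m\<close> is an alternating sum of the \<open>e\<^sup>h\<^sup>u\<close>, whose coefficient of \<open>u\<^sup>m\<^sup>+\<^sup>k\<close>
  is the sum that defines \<open>P\<^sub>k\<close>, divided by \<open>(m + k)!\<close>.
\<close>
lemma poly_Ppoly_eq_fps_nth:
  "poly (Ppoly k) (real m) = fps_nth (Abs_fps (\<lambda>j. 1 / fact (Suc j)) ^ m) k"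
proof -
  define F :: "real fps" where "F = Abs_fps (\<lambda>j. 1 / fact (Suc j))"
  have XF: "fps_X * F = fps_exp 1 - 1"
  proof (rule fps_ext)
    fix n show "fps_nth (fps_X * F) n = fps_nth (fps_exp 1 - 1) n"
      by (cases n) (simp_all add: F_def field_simps)
  qed
  have sgn: "(- 1 :: real) powi (int l - 1) = - ((- 1) ^ l)" for l
    by (simp add: power_int_diff)
  have "(fps_exp 1 - 1 :: real fps) ^ m = (\<Sum>h\<le>m. of_nat (m choose h) * fps_exp 1 ^ h * (- 1) ^ (m - h))"
    using binomial_ring[of "fps_exp 1" "- 1 :: real fps" m] by simp
  also have "\<dots> = (\<Sum>h\<le>m. fps_const (real (m choose h) * (- 1) ^ (m - h)) * fps_exp (real h))"
  proof (intro sum.cong refl)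
    fix h
    have "(- 1 :: real fps) ^ (m - h) = fps_const ((- 1) ^ (m - h))"
      by (metis fps_const_1_eq_1 fps_const_neg fps_const_power)
    then show "of_nat (m choose h) * fps_exp 1 ^ h * (- 1) ^ (m - h)
        = fps_const (real (m choose h) * (- 1) ^ (m - h)) * fps_exp (real h)"
      by (simp only: fps_of_nat [symmetric] fps_exp_power_mult fps_const_mult [symmetric]
          mult_1_left mult_1_right mult_ac)
  qed
  finally have "fps_nth ((fps_X * F) ^ m) (m + k)
      = (\<Sum>h\<le>m. real (m choose h) * (- 1) ^ (m - h) * (real h ^ (m + k) / fact (m + k)))"
    by (simp add: XF fps_sum_nth)
  then have "fact (m + k) * fps_nth (F ^ m) k
      = (\<Sum>h\<le>m. real (m choose h) * (- 1) ^ (m - h) * real h ^ (m + k))"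
    by (simp add: power_mult_distrib fps_X_power_mult_nth sum_distrib_left)
  also have "\<dots> = (- 1) ^ m * (\<Sum>h=0..m. real h ^ (m + k) * (- 1) ^ h * real (m choose h))"
    unfolding sum_distrib_left
    by (intro sum.cong) (auto simp: minus_one_power_iff)
  also have "(\<Sum>h=0..m. real h ^ (m + k) * (- 1) ^ h * real (m choose h))
      = - (\<Sum>h=0..m. real h ^ (m + k) * (- 1) powi (int h - 1) * real (m choose h))"
    by (simp add: sgn sum_negf)
  also have "\<dots> = (- 1) ^ m * poly (Ppoly k) (real m) * fact (m + k)"
    using is_P_Ppoly[of k] unfolding is_P_def by (simp add: sgn)
  finally show ?thesis
    by (simp add: F_def minus_one_power_iff split: if_splits)
qed

lemma poly_Ppoly_1: "poly (Ppoly 1) (real m) = real m / 2"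
  and poly_Ppoly_2: "poly (Ppoly 2) (real m) = real m * (3 * real m + 1) / 24"
proof -
  have "fps_nth (Abs_fps (\<lambda>j. 1 / fact (Suc j) :: real)) 0 = 1" by simp
  note low = fps_power_nth_low[OF this, of m]
  show "poly (Ppoly 1) (real m) = real m / 2"
    unfolding poly_Ppoly_eq_fps_nth low by (simp add: fact_numeral)
  show "poly (Ppoly 2) (real m) = real m * (3 * real m + 1) / 24"
    unfolding poly_Ppoly_eq_fps_nth low by (simp add: fact_numeral field_simps power2_eq_square eval_nat_numeral)
qed

text \<open>
  Modulo \<open>q\<^sup>3\<close> one has \<open>y = exp (- 2 \<nu> q)\<close> and \<open>x = exp (- \<nu> q - \<nu> \<alpha>\<^sub>2 q\<^sup>2)\<close>, so that
  \<open>x y\<^sup>h = exp (- (1 + 2h) \<nu> q) exp (- \<nu> \<alpha>\<^sub>2 q\<^sup>2)\<close>. The coefficients of the combination are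
  thus expressed by the moments \<open>T\<close> with respect to \<open>1 + 2h\<close>.
\<close>
lemma low_order_moments:
  fixes m :: nat and x y :: "complex fps" and b :: "nat \<Rightarrow> int" and \<nu> \<alpha>\<^sub>2 :: complex
  assumes x: "fps_nth x 0 = 1" "fps_nth (fps_log x) 1 = - \<nu>" "fps_nth (fps_log x) 2 = - \<nu> * \<alpha>\<^sub>2"
    and y: "fps_nth y 0 = 1" "fps_nth (fps_log y) 1 = - 2 * \<nu>" "fps_nth (fps_log y) 2 = 0"
  defines "T \<equiv> \<lambda>j. \<Sum>h=0..m. (1 + 2 * of_nat h) ^ j * of_int (b h)"
    and "F \<equiv> x * (\<Sum>h=0..m. of_int (b h) * y ^ h)"
  shows "fps_nth F 0 = T 0" "fps_nth F 1 = - \<nu> * T 1"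
    "fps_nth F 2 = \<nu>\<^sup>2 / 2 * T 2 - \<nu> * \<alpha>\<^sub>2 * T 0"
proof -
  define R where "R = (\<Sum>h=0..m. of_int (b h) * y ^ h)"
  have nth_c: "fps_nth (of_int i * G) k = of_int i * fps_nth G k" for i k and G :: "complex fps"
    by (simp add: fps_of_int [symmetric])
  have x12: "fps_nth x 1 = - \<nu>" "fps_nth x 2 = - \<nu> * \<alpha>\<^sub>2 + \<nu>\<^sup>2 / 2"
    using fps_nth_from_log[OF x(1)] x by simp_all
  have y12: "fps_nth y 1 = - 2 * \<nu>" "fps_nth y 2 = 2 * \<nu>\<^sup>2"
    using fps_nth_from_log[OF y(1)] y by (simp_all add: power2_eq_square)
  have R0: "fps_nth R 0 = T 0"
    by (simp add: R_def T_def fps_sum_nth nth_c fps_power_zeroth y(1))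
  have R1: "fps_nth R 1 = - \<nu> * (T 1 - T 0)"
    unfolding R_def T_def fps_sum_nth nth_c fps_power_nth_low[OF y(1)] y12
      sum_subtractf[symmetric] sum_distrib_left
    by (intro sum.cong) (auto simp: algebra_simps)
  have R2: "fps_nth R 2 = \<nu>\<^sup>2 / 2 * (T 2 - 2 * T 1 + T 0)"
    unfolding R_def T_def fps_sum_nth nth_c fps_power_nth_low[OF y(1)] y12
      sum_subtractf[symmetric] sum_distrib_left sum.distrib[symmetric]
    by (intro sum.cong) (auto simp: field_simps power2_eq_square)
  have F: "F = x * R" by (simp add: F_def R_def)
  show "fps_nth F 0 = T 0" by (simp add: F R0 x)
  show "fps_nth F 1 = - \<nu> * T 1"
    using R0 R1 x12 by (simp add: F fps_mult_nth x algebra_simps)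
  have "fps_nth F 2 = fps_nth x 0 * fps_nth R 2 + fps_nth x 1 * fps_nth R 1 + fps_nth x 2 * fps_nth R 0"
    by (simp add: F fps_mult_nth eval_nat_numeral)
  also have "\<dots> = \<nu>\<^sup>2 / 2 * T 2 - \<nu> * \<alpha>\<^sub>2 * T 0"
    unfolding R0 R1 R2 x12 x(1) by (simp add: field_simps power2_eq_square)
  finally show "fps_nth F 2 = \<nu>\<^sup>2 / 2 * T 2 - \<nu> * \<alpha>\<^sub>2 * T 0" .
qed

text \<open>
  Here \<open>(1 - y) / q = 2 \<nu> (1 - \<nu> q + (\<alpha>\<^sub>3 + 2 \<nu>\<^sup>2 / 3) q\<^sup>2 + \<dots>)\<close>. The power has to be known
  modulo \<open>q\<^sup>3\<close>, and the division by \<open>q\<close> brings in the coefficient of \<open>q\<^sup>3\<close> in \<open>log y\<close>.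
\<close>
lemma low_order_power_of_one_minus:
  fixes m :: nat and y :: "complex fps" and \<nu> \<alpha>\<^sub>3 :: complex
  assumes y: "fps_nth y 0 = 1" "fps_nth (fps_log y) 1 = - 2 * \<nu>" "fps_nth (fps_log y) 2 = 0"
    "fps_nth (fps_log y) 3 = - 2 * \<nu> * \<alpha>\<^sub>3" and "\<nu> \<noteq> 0"
  defines "G \<equiv> fps_shift 1 (1 - y) ^ m"
  shows "fps_nth G 0 = (2 * \<nu>) ^ m" "fps_nth G 1 = - of_nat m * \<nu> * (2 * \<nu>) ^ m"
    "fps_nth G 2 = (of_nat m * \<alpha>\<^sub>3 + \<nu>\<^sup>2 * of_nat m * (3 * of_nat m + 1) / 6) * (2 * \<nu>) ^ m"
proof -
  define S where "S = fps_const (1 / (2 * \<nu>)) * fps_shift 1 (1 - y)"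
  have y123: "fps_nth y 1 = - 2 * \<nu>" "fps_nth y 2 = 2 * \<nu>\<^sup>2"
    "fps_nth y 3 = - 2 * \<nu> * \<alpha>\<^sub>3 - 4 / 3 * \<nu> ^ 3"
    using fps_nth_from_log[OF y(1)] y by (simp_all add: power2_eq_square power3_eq_cube)
  have S: "fps_nth S 0 = 1" "fps_nth S 1 = - \<nu>" "fps_nth S 2 = \<alpha>\<^sub>3 + 2 / 3 * \<nu>\<^sup>2"
  proof -
    have *: "fps_nth S 0 = - fps_nth y 1 / (2 * \<nu>)" "fps_nth S 1 = - fps_nth y 2 / (2 * \<nu>)"
      "fps_nth S 2 = - fps_nth y 3 / (2 * \<nu>)"
      by (simp_all add: S_def numeral_2_eq_2 numeral_3_eq_3)
    show "fps_nth S 0 = 1" "fps_nth S 1 = - \<nu>" "fps_nth S 2 = \<alpha>\<^sub>3 + 2 / 3 * \<nu>\<^sup>2"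
      unfolding * y123 using \<open>\<nu> \<noteq> 0\<close>
      by (simp_all add: field_simps power2_eq_square power3_eq_cube)
  qed
  have "fps_shift 1 (1 - y) = fps_const (2 * \<nu>) * S"
    using \<open>\<nu> \<noteq> 0\<close> by (simp add: S_def fps_eq_iff)
  then have G: "G = fps_const ((2 * \<nu>) ^ m) * S ^ m"
    unfolding G_def by (simp only: power_mult_distrib fps_const_power)
  show "fps_nth G 0 = (2 * \<nu>) ^ m" by (simp add: G S fps_power_zeroth)
  show "fps_nth G 1 = - of_nat m * \<nu> * (2 * \<nu>) ^ m"
    unfolding G fps_mult_left_const_nth fps_power_nth_low[OF S(1)] S by simp
  show "fps_nth G 2 = (of_nat m * \<alpha>\<^sub>3 + \<nu>\<^sup>2 * of_nat m * (3 * of_nat m + 1) / 6) * (2 * \<nu>) ^ m"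
    unfolding G fps_mult_left_const_nth fps_power_nth_low[OF S(1)] S
    by (simp add: field_simps power2_eq_square)
qed

theorem theorem5p1:
  fixes p m n :: nat and a :: "nat \<Rightarrow> nat \<Rightarrow> int"
  assumes "prime p" and "odd p"
    and "m > 0" and "n > 0" and "coprime m n"
    and "(real p + 1) / 8 = real m / real n"
    and "is_modular_matrix p m n a"
  shows "(\<Sum>h=0..m. real_of_int (a 1 h)) = - (real n ^ m) * 2 powi (int m - int n) \<and>
    (\<Sum>h=0..m. (1 + 2 * real h) * real_of_int (a 1 h))
      = - (real n ^ m) * 2 powi (int m + 1 - int n) * poly (Ppoly 1) (real m) \<and>
    (\<Sum>h=0..m. (1 + 2 * real h) ^ 2 * real_of_int (a 1 h))
      = - (real n ^ m) * 2 powi (int m + 3 - int n) * poly (Ppoly 2) (real m)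
        - real n powi (int m - 1) * 2 powi (int m + 1 - int n) * alpha p 2
        - real n powi (int m - 2) * 2 powi (int m + 1 - int n) * real m * alpha p 3"
proof -
  have p3: "p \<ge> 3"
    using prime_ge_2_nat[OF \<open>prime p\<close>] \<open>odd p\<close> by (cases "p = 2") auto
  then have p0: "p > 0" by simp
  define T where "T j = (\<Sum>h=0..m. (1 + 2 * real h) ^ j * real_of_int (a 1 h))" for j :: nat
  define x where "x = modX_fps p n"
  define y where "y = modY_fps p n"
  define F where "F = x * (\<Sum>h=0..m. of_int (a 1 h) * y ^ h)"
  have logx: "fps_nth (fps_log x) 1 = - of_nat n"
    "fps_nth (fps_log x) 2 = - of_nat n * of_real (alpha p 2)"
    using low_order_log_coefficients[OF p3] by (simp_all add: x_def fps_log_modX_nth[OF p0])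
  have logy: "fps_nth (fps_log y) 1 = - 2 * of_nat n" "fps_nth (fps_log y) 2 = 0"
    "fps_nth (fps_log y) 3 = - 2 * of_nat n * of_real (alpha p 3)"
    using low_order_log_coefficients[OF p3] by (simp_all add: y_def fps_log_modY_nth_odd[OF p0])
  have xy0: "fps_nth x 0 = 1" "fps_nth y 0 = 1" by (simp_all add: x_def y_def)

  have F: "fps_nth F 0 = of_real (T 0)" "fps_nth F 1 = of_real (- real n * T 1)"
    "fps_nth F 2 = of_real (real n ^ 2 / 2 * T 2 - real n * alpha p 2 * T 0)"
    using low_order_moments[OF xy0(1) logx xy0(2) logy(1,2), where m = m and b = "a 1"]
    by (simp_all add: F_def T_def)
  have G: "fps_nth (fps_shift 1 (1 - y) ^ m) 0 = of_real ((2 * real n) ^ m)"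
    "fps_nth (fps_shift 1 (1 - y) ^ m) 1 = of_real (- real m * real n * (2 * real n) ^ m)"
    "fps_nth (fps_shift 1 (1 - y) ^ m) 2 = of_real ((real m * alpha p 3
      + real n ^ 2 * real m * (3 * real m + 1) / 6) * (2 * real n) ^ m)"
    using low_order_power_of_one_minus[OF xy0(2) logy, where m = m] \<open>n > 0\<close> by simp_all
  have row: "2 ^ n * u = - v"
    if "j < m" "fps_nth F j = of_real u" "fps_nth (fps_shift 1 (1 - y) ^ m) j = of_real v" for j u v
  proof -
    have "fps_nth y 1 \<noteq> 0"
      using fps_nth_from_log(1)[OF xy0(2)] logy \<open>n > 0\<close> by simp
    then have "fps_nth (fps_const (2 ^ n) * x * (\<Sum>h=0..m. of_int (a 1 h) * y ^ h)) j
        = - fps_nth (fps_shift 1 (1 - y) ^ m) j"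
      using that(1) assms xy0 modular_relation_fps[OF assms(7) p0]
      by (intro second_row_from_relation) (auto simp: x_def y_def is_modular_matrix_def)
    then have "2 ^ n * fps_nth F j = - fps_nth (fps_shift 1 (1 - y) ^ m) j"
      by (simp add: F_def mult.assoc)
    then have "complex_of_real (2 ^ n * u) = of_real (- v)"
      unfolding that(2,3) by simp
    then show ?thesis unfolding of_real_eq_iff .
  qed
  \<comment> \<open>Kept opaque so that only rational functions of \<open>n\<close> and \<open>m\<close> are left to compare.\<close>
  define A where "A = real n ^ m"
  define B where "B = (2 :: real) ^ m / 2 ^ n"
  have AB: "(2 * real n) ^ m = 2 ^ n * (A * B)"
    by (simp add: A_def B_def power_mult_distrib)
  \<comment> \<open>The coefficient of \<open>q\<^sup>0\<close> is known for every \<open>m \<ge> 1\<close>, the one of \<open>q\<^sup>2\<close> only for \<open>m \<ge> 3\<close>.\<close>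
  have "2 ^ n * T 0 = 2 ^ n * - (A * B)"
    using row[OF \<open>m > 0\<close> F(1) G(1)[unfolded AB]] by (simp only: mult_minus_right)
  then have T0: "T 0 = - (A * B)" by (subst (asm) mult_left_cancel) auto

  have pow: "2 powi (int m - int n) = B" "2 powi (int m + 1 - int n) = 2 * B"
    "2 powi (int m + 3 - int n) = 8 * B"
    "real n powi (int m - 1) = A / real n" "real n powi (int m - 2) = A / real n ^ 2"
    using \<open>n > 0\<close> by (simp_all add: power_int_diff power_int_add A_def B_def)

  have "T 0 = - A * 2 powi (int m - int n) \<and>
    T 1 = - A * 2 powi (int m + 1 - int n) * poly (Ppoly 1) (real m) \<and>
    T 2 = - A * 2 powi (int m + 3 - int n) * poly (Ppoly 2) (real m)
        - real n powi (int m - 1) * 2 powi (int m + 1 - int n) * alpha p 2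
        - real n powi (int m - 2) * 2 powi (int m + 1 - int n) * real m * alpha p 3"
  proof (cases "m < 3")
    case False
    have "2 ^ n * (- real n * T 1) = - (- real m * real n * (2 ^ n * (A * B)))"
      using False by (intro row[OF _ F(2) G(2)[unfolded AB]]) simp
    then have "2 ^ n * real n * T 1 = 2 ^ n * real n * - (A * B * real m)"
      by (simp add: algebra_simps)
    then have T1: "T 1 = - (A * B * real m)"
      using \<open>n > 0\<close> by (subst (asm) mult_left_cancel) auto
    have "2 ^ n * (real n ^ 2 / 2 * T 2 - real n * alpha p 2 * T 0) =
      - ((real m * alpha p 3 + real n ^ 2 * real m * (3 * real m + 1) / 6) * (2 ^ n * (A * B)))"
      using False by (intro row[OF _ F(3) G(3)[unfolded AB]]) simp
    also have "\<dots> = 2 ^ n *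
      - ((real m * alpha p 3 + real n ^ 2 * real m * (3 * real m + 1) / 6) * (A * B))"
      by (simp add: mult_ac)
    finally have "real n ^ 2 / 2 * T 2 - real n * alpha p 2 * T 0 =
      - ((real m * alpha p 3 + real n ^ 2 * real m * (3 * real m + 1) / 6) * (A * B))"
      by (subst (asm) mult_left_cancel) auto
    then have "real n ^ 2 / 2 * T 2 = - (real n * alpha p 2 + real m * alpha p 3
        + real n ^ 2 * real m * (3 * real m + 1) / 6) * (A * B)"
      unfolding T0 by (simp add: algebra_simps)
    moreover have "T 2 = 2 / real n ^ 2 * (real n ^ 2 / 2 * T 2)"
      using \<open>n > 0\<close> by simp
    ultimately have T2: "T 2 = 2 / real n ^ 2 * (- (real n * alpha p 2 + real m * alpha p 3
        + real n ^ 2 * real m * (3 * real m + 1) / 6) * (A * B))"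
      by simp
    show ?thesis
      unfolding T0 T1 T2 pow poly_Ppoly_1 poly_Ppoly_2
      using \<open>n > 0\<close> by (simp add: field_simps power2_eq_square)
  next
    case True
    \<comment> \<open>Here \<open>m = 2\<close> gives \<open>n = 1\<close> and \<open>p = 15\<close>, which is not prime, and \<open>m = 1\<close> gives
       \<open>p = 7\<close> or \<open>p = 3\<close>.\<close>
    have eq: "n * (p + 1) = 8 * m"
    proof -
      have "real (n * (p + 1)) = real (8 * m)"
        using assms(6) \<open>n > 0\<close> by (simp add: field_simps)
      then show ?thesis by (simp only: of_nat_eq_iff)
    qed
    have "m \<noteq> 2"
    proof
      assume "m = 2"
      then have "n dvd 16" "odd n"
        using eq \<open>coprime m n\<close> by (auto intro: dvdI[of _ n "p + 1"])
      have "coprime n (2 ^ 4)"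
        unfolding coprime_power_right_iff using \<open>odd n\<close> by simp
      moreover have "n dvd 2 ^ 4" using \<open>n dvd 16\<close> by simp
      ultimately have "n = 1" by (metis coprime_absorb_left nat_dvd_1_iff_1)
      with eq \<open>m = 2\<close> have "p = 15" by simp
      moreover have "(3 :: nat) dvd 15" by simp
      ultimately have "(3 :: nat) = 1 \<or> (3 :: nat) = 15"
        using \<open>prime p\<close> unfolding prime_nat_iff by blast
      then show False by simp
    qed
    with True \<open>m > 0\<close> have m: "m = 1" by simp
    have "n * 4 \<le> n * (p + 1)" using p3 by (intro mult_le_mono2) simp
    with eq m have "n \<le> 2" by simp
    with \<open>n > 0\<close> have "n = 1 \<or> n = 2" by auto
    then have np: "n = 1 \<and> p = 7 \<or> n = 2 \<and> p = 3"
      using eq m by auto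
    \<comment> \<open>The support condition on the matrix leaves the single entry \<open>a 1 0\<close> in the row.\<close>
    have "a 1 1 = 0" using assms(7) m by (auto simp: is_modular_matrix_def)
    then have T12: "T j = T 0" for j by (simp add: T_def m)
    show ?thesis
      using np
    proof (elim disjE conjE)
      assume "n = 1" "p = 7"
      then show ?thesis
        using low_order_log_coefficients(2,3)[OF p3] unfolding T12[of 1] T12[of 2] T0 pow poly_Ppoly_1 poly_Ppoly_2
        by (simp add: A_def B_def m)
    next
      assume "n = 2" "p = 3"
      then show ?thesis
        using low_order_log_coefficients(2,3)[OF p3] unfolding T12[of 1] T12[of 2] T0 pow poly_Ppoly_1 poly_Ppoly_2
        by (simp add: A_def B_def m)
    qed
  qed
  then show ?thesis by (simp add: T_def A_def)
qed

end
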